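(* Let $X$ be a field and let $K_i, L_i, M_i, N_i : X \to [0, \infty)$ be functions for $i = 1, 2$. Suppose that a function $f : X^4 \to \mathbb{C}$ satisfies the inequality $$\begin{aligned} \big| f(x_1, y_1, z_1, w_1) f(x_2, y_2, z_2, w_2) - f(&x_1 x_2 + y_1 y_2 + z_1 z_2 + w_1 w_2,\\ &x_1 y_2 - y_1 x_2 + z_1 w_2 - w_1 z_2,\\ &x_1 z_2 - y_1 w_2 - z_1 x_2 + w_1 y_2,\\ &x_1 w_2 + y_1 z_2 - z_1 y_2 - w_1 x_2) \big|\\ \leq \min\{ K_1(x_1), K_2(x_2), &L_1(y_1), L_2(y_2), M_1(z_1), M_2(z_2), N_1(w_1), N_2(w_2) \} \end{aligned}$$ for all $x_i, y_i, z_i, w_i \in X$ $(i = 1, 2)$. Then the function $x \mapsto f(x, 0, 0, 0)$ from $X$ to $\mathbb{C}$ is either bounded or multiplicative, and furthermore $$\left| f(x,y,z,w)^2 - f(x^2+y^2+z^2+w^2, 0, 0, 0) \right| \leq \min\{ K_1(x), K_2(x), L_1(y), L_2(y), M_1(z), M_2(z), N_1(w), N_2(w) \}$$ for all $x, y, z, w \in X$.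
   Context: A function $m : X \to \mathbb{C}$ on a field $X$ is called multiplicative if $m(xy) = m(x)m(y)$ for all $x, y \in X$. It is bounded if $\sup_{x \in X} |m(x)| < \infty$. *)

theory Defs
  imports "HOL-Analysis.Analysis"
begin

definition multiplicative :: "('a::field \<Rightarrow> complex) \<Rightarrow> bool" where
  "multiplicative m \<longleftrightarrow> (\<forall>x y. m (x * y) = m x * m y)"

end

theory Submission
  imports Defs
begin

text \<open>
  Both conclusions come from specialising the two arguments of the inequality. Read
  \<open>(x, y, z, w)\<close> as a quaternion over the field: the argument of the last \<open>f\<close> is the second
  quaternion times the conjugate of the first. If both are equal, this product is the norm
  \<open>x\<^sup>2 + y\<^sup>2 + z\<^sup>2 + w\<^sup>2\<close>, a scalar, which gives the second estimate.
  If both are scalars \<open>(x, 0, 0, 0)\<close> and \<open>(y, 0, 0, 0)\<close>, the product is the scalar \<open>x * y\<close>,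
  and the constant \<open>L1 0\<close> is among the bounds. Hence \<open>\<lambda>x. f (x, 0, 0, 0)\<close> is multiplicative up
  to an error bounded uniformly in \<open>x\<close> and \<open>y\<close>, and Baker's superstability argument
  (\<open>approx_multiplicative_bounded_or_multiplicative\<close>) gives the dichotomy.
\<close>

text \<open>
  By associativity, \<open>m z * (m x * m y - m (x * y))\<close> is small: pass from \<open>m z * m x * m y\<close> to
  \<open>m (z * x) * m y\<close>, then to \<open>m (z * x * y)\<close>, and back to \<open>m z * m (x * y)\<close>. The total error
  \<open>e * (norm (m y) + 2)\<close> does not depend on \<open>z\<close>. A nonzero defect at a single pair \<open>(x, y)\<close>
  therefore bounds \<open>m\<close> everywhere.
\<close>

lemma approx_multiplicative_bounded_or_multiplicative:
  fixes m :: "'a::semigroup_mult \<Rightarrow> 'b::real_normed_div_algebra"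
  assumes approx: "\<And>x y. norm (m x * m y - m (x * y)) \<le> e"
  shows "bounded (range m) \<or> (\<forall>x y. m (x * y) = m x * m y)"
proof (rule disjCI)
  assume "\<not> (\<forall>x y. m (x * y) = m x * m y)"
  then obtain x y where xy: "m x * m y - m (x * y) \<noteq> 0" (is "?d \<noteq> 0")
    by force
  have "norm (m z) \<le> e * (norm (m y) + 2) / norm ?d" for z
  proof -
    have "m z * ?d = (m z * m x - m (z * x)) * m y
        + (m (z * x) * m y - m (z * x * y)) - (m z * m (x * y) - m (z * (x * y)))"
      by (simp add: algebra_simps)
    also have "norm \<dots> \<le> norm ((m z * m x - m (z * x)) * m y)
        + norm (m (z * x) * m y - m (z * x * y)) + norm (m z * m (x * y) - m (z * (x * y)))"
      by (intro order_trans[OF norm_triangle_ineq4] add_right_mono norm_triangle_ineq)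
    also have "\<dots> \<le> e * norm (m y) + e + e"
      unfolding norm_mult[of _ "m y"] by (intro add_mono mult_right_mono approx norm_ge_zero)
    finally have "norm (m z) * norm ?d \<le> e * (norm (m y) + 2)"
      unfolding norm_mult[of "m z" ?d] by (simp add: algebra_simps)
    then show ?thesis
      using xy by (simp add: pos_le_divide_eq)
  qed
  then show "bounded (range m)"
    by (auto intro!: boundedI)
qed

theorem theorem5:
  fixes f :: "'a::field \<times> 'a \<times> 'a \<times> 'a \<Rightarrow> complex"
    and K1 K2 L1 L2 M1 M2 N1 N2 :: "'a \<Rightarrow> real"
  assumes nonneg: "\<And>x. K1 x \<ge> 0" "\<And>x. K2 x \<ge> 0" "\<And>x. L1 x \<ge> 0" "\<And>x. L2 x \<ge> 0"
      "\<And>x. M1 x \<ge> 0" "\<And>x. M2 x \<ge> 0" "\<And>x. N1 x \<ge> 0" "\<And>x. N2 x \<ge> 0"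
    and ineq: "\<And>x1 y1 z1 w1 x2 y2 z2 w2.
      cmod (f (x1, y1, z1, w1) * f (x2, y2, z2, w2)
            - f (x1 * x2 + y1 * y2 + z1 * z2 + w1 * w2,
                 x1 * y2 - y1 * x2 + z1 * w2 - w1 * z2,
                 x1 * z2 - y1 * w2 - z1 * x2 + w1 * y2,
                 x1 * w2 + y1 * z2 - z1 * y2 - w1 * x2))
      \<le> Min {K1 x1, K2 x2, L1 y1, L2 y2, M1 z1, M2 z2, N1 w1, N2 w2}"
  shows "(bounded (range (\<lambda>x. f (x, 0, 0, 0))) \<or> multiplicative (\<lambda>x. f (x, 0, 0, 0))) \<and>
    (\<forall>x y z w. cmod ((f (x, y, z, w))\<^sup>2 - f (x\<^sup>2 + y\<^sup>2 + z\<^sup>2 + w\<^sup>2, 0, 0, 0))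
      \<le> Min {K1 x, K2 x, L1 y, L2 y, M1 z, M2 z, N1 w, N2 w})"
proof (intro conjI allI)
  have "cmod (f (x, 0, 0, 0) * f (y, 0, 0, 0) - f (x * y, 0, 0, 0)) \<le> L1 0" for x y
  proof -
    have "cmod (f (x, 0, 0, 0) * f (y, 0, 0, 0) - f (x * y, 0, 0, 0))
        \<le> Min {K1 x, K2 y, L1 0, L2 0, M1 0, M2 0, N1 0, N2 0}"
      using ineq[of x 0 0 0 y 0 0 0] unfolding mult_zero_left mult_zero_right add_0_right diff_0_right .
    also have "\<dots> \<le> L1 0"
      by (rule Min_le) blast+
    finally show ?thesis .
  qed
  from approx_multiplicative_bounded_or_multiplicative[of "\<lambda>x. f (x, 0, 0, 0)", OF this]
  show "bounded (range (\<lambda>x. f (x, 0, 0, 0))) \<or> multiplicative (\<lambda>x. f (x, 0, 0, 0))"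
    by (simp add: multiplicative_def)
next
  fix x y z w
  show "cmod ((f (x, y, z, w))\<^sup>2 - f (x\<^sup>2 + y\<^sup>2 + z\<^sup>2 + w\<^sup>2, 0, 0, 0))
      \<le> Min {K1 x, K2 x, L1 y, L2 y, M1 z, M2 z, N1 w, N2 w}"
  proof -
    have "x * y - y * x + z * w - w * z = 0" "x * z - y * w - z * x + w * y = 0"
        "x * w + y * z - z * y - w * x = 0"
      by (simp_all add: mult.commute)
    then show ?thesis
      using ineq[of x y z w x y z w] unfolding power2_eq_square by (simp only:)
  qed
qed

end
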